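(* Let $X$ be a proper metric space, $Y$ a metric space, and $F\colon X\to Y$ an $L$-Lipschitz quotient mapping. Let $\gamma\colon[0,T]\to Y$ be a $1$-Lipschitz curve with $\gamma(0)=F(x)$ for some $x\in X$. Then there is an $L$-Lipschitz curve $\tilde\gamma\colon[0,T]\to X$ with $\tilde\gamma(0)=x$ and $F\circ\tilde\gamma=\gamma$.
   Context: A metric space is proper if closed balls are compact. $F\colon X\to Y$ is an $L$-Lipschitz quotient ($L$-LQ) mapping, $L\ge1$, if $B(F(x),r/L)\subseteq F(B(x,r))\subseteq B(F(x),Lr)$ for all $x\in X$, $r>0$, where $B$ denotes open balls. *)

theory Defs
  imports "HOL-Analysis.Analysis"
begin

definition proper_metric_space :: "'a::metric_space itself \<Rightarrow> bool" where
  "proper_metric_space _ \<longleftrightarrow> (\<forall>(x::'a) r. compact (cball x r))"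

definition lipschitz_quotient ::
  "real \<Rightarrow> ('a::metric_space \<Rightarrow> 'b::metric_space) \<Rightarrow> bool" where
  "lipschitz_quotient L F \<longleftrightarrow> L \<ge> 1 \<and>
     (\<forall>x r. r > 0 \<longrightarrow> ball (F x) (r / L) \<subseteq> F ` ball x r \<and> F ` ball x r \<subseteq> ball (F x) (L * r))"

end

theory Submission
  imports Defs "HOL-Complex_Analysis.Great_Picard"
begin

text \<open>Sample \<gamma> on a grid of mesh h and lift the samples one after another: since F maps
  ball p (L r) onto a superset of ball (F p) r, consecutive lifts can be chosen at distance
  about L h. The resulting step functions are L-Lipschitz up to an error that vanishes with
  the mesh, and they take values in one closed ball, which is compact because X is proper.
  A diagonal subsequence converges on a countable dense set of times; the approximate
  Lipschitz bound upgrades this to pointwise convergence everywhere, towards an L-Lipschitz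
  limit, and continuity of F shows that the limit lifts \<gamma>.\<close>

lemma lipschitz_quotient_imp_lipschitz:
  assumes "lipschitz_quotient L F"
  shows "L-lipschitz_on UNIV F"
proof -
  have L1: "L \<ge> 1" using assms by (simp add: lipschitz_quotient_def)
  have "dist (F y) (F z) \<le> L * dist y z" for y z
  proof (rule field_le_epsilon)
    fix \<epsilon> :: real assume "0 < \<epsilon>"
    define r where "r = dist y z + \<epsilon> / L"
    have "r > 0" "y \<in> ball z r" using \<open>0 < \<epsilon>\<close> L1 by (simp_all add: r_def add_nonneg_pos dist_commute)
    then have "dist (F y) (F z) < L * r"
      using assms unfolding lipschitz_quotient_def by (force simp: dist_commute)
    also have "L * r = L * dist y z + \<epsilon>" using L1 by (simp add: r_def algebra_simps)
    finally show "dist (F y) (F z) \<le> L * dist y z + \<epsilon>" by simp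
  qed
  with L1 show ?thesis by (simp add: lipschitz_on_def)
qed

lemma lipschitz_quotient_lift_point:
  assumes "lipschitz_quotient L F" "dist (F p) w < a"
  shows "\<exists>y. F y = w \<and> dist p y < L * a"
proof -
  have L1: "L \<ge> 1" using assms by (simp add: lipschitz_quotient_def)
  have "0 < a" using assms(2) by (meson le_less_trans zero_le_dist)
  then have "0 < L * a" using L1 by simp
  moreover have "w \<in> ball (F p) (L * a / L)" using assms(2) L1 by simp
  ultimately have "w \<in> F ` ball p (L * a)" using assms(1) unfolding lipschitz_quotient_def by blast
  then show ?thesis by auto
qed

lemma lipschitz_quotient_lift_chain:
  assumes "lipschitz_quotient L F" "w 0 = F x" "\<And>k. dist (w k) (w (Suc k)) < a"
  obtains p where "p 0 = x" "\<And>k. F (p k) = w k" "\<And>k. dist (p k) (p (Suc k)) < L * a"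
proof -
  have "\<exists>y. F q = w k \<longrightarrow> F y = w (Suc k) \<and> dist q y < L * a" for q k
    using lipschitz_quotient_lift_point[OF assms(1)] assms(3) by metis
  then obtain next_lift where
    next_lift: "\<And>q k. F q = w k \<Longrightarrow> F (next_lift q k) = w (Suc k) \<and> dist q (next_lift q k) < L * a"
    by metis
  define p where "p = rec_nat x (\<lambda>k q. next_lift q k)"
  have p0: "p 0 = x" and pSuc: "\<And>k. p (Suc k) = next_lift (p k) k" by (simp_all add: p_def)
  have pF: "F (p k) = w k" for k
    by (induction k) (simp_all add: p0 assms(2) pSuc next_lift)
  show ?thesis
    using that p0 pF pSuc next_lift by metis
qed

lemma dist_chain_le:
  fixes p :: "nat \<Rightarrow> 'a::metric_space"
  assumes step: "\<And>k. dist (p k) (p (Suc k)) \<le> D"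
  shows "dist (p i) (p j) \<le> \<bar>real i - real j\<bar> * D"
proof -
  have forward: "dist (p i) (p (i + n)) \<le> real n * D" for i n
  proof (induction n)
    case (Suc n)
    have "dist (p i) (p (i + Suc n)) \<le> dist (p i) (p (i + n)) + dist (p (i + n)) (p (Suc (i + n)))"
      by (simp add: dist_triangle)
    also have "\<dots> \<le> real n * D + D" using Suc step by (intro add_mono)
    finally show ?case by (simp add: algebra_simps)
  qed simp
  show ?thesis
  proof (cases "i \<le> j")
    case True
    then show ?thesis using forward[of i "j - i"] by (simp add: of_nat_diff)
  next
    case False
    then show ?thesis using forward[of j "i - j"] by (simp add: of_nat_diff dist_commute)
  qed
qed

lemma grid_index_bounds:
  fixes h t :: real
  assumes "h > 0" "0 \<le> t"
  shows "real (nat \<lfloor>t / h\<rfloor>) * h \<le> t" "t < real (nat \<lfloor>t / h\<rfloor>) * h + h"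
proof -
  have idx: "real (nat \<lfloor>t / h\<rfloor>) = of_int \<lfloor>t / h\<rfloor>"
    using assms by simp
  show "real (nat \<lfloor>t / h\<rfloor>) * h \<le> t"
    unfolding idx using floor_divide_lower[OF \<open>h > 0\<close>] .
  show "t < real (nat \<lfloor>t / h\<rfloor>) * h + h"
    unfolding idx using floor_divide_upper[OF \<open>h > 0\<close>, of t] by (simp add: distrib_right)
qed

lemma grid_index_le:
  fixes h t :: real
  assumes "h > 0" "0 \<le> t" "t \<le> real N * h"
  shows "nat \<lfloor>t / h\<rfloor> \<le> N"
proof -
  have "real (nat \<lfloor>t / h\<rfloor>) * h \<le> real N * h"
    using grid_index_bounds(1)[OF assms(1,2)] assms(3) by linarith
  then show ?thesis using \<open>h > 0\<close> by simp
qed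

lemma grid_index_diff:
  fixes h s t :: real
  assumes "h > 0" "0 \<le> s" "0 \<le> t"
  shows "\<bar>real (nat \<lfloor>s / h\<rfloor>) - real (nat \<lfloor>t / h\<rfloor>)\<bar> * h \<le> \<bar>s - t\<bar> + h"
proof -
  have "\<bar>real (nat \<lfloor>s / h\<rfloor>) - real (nat \<lfloor>t / h\<rfloor>)\<bar> * h
      = \<bar>real (nat \<lfloor>s / h\<rfloor>) * h - real (nat \<lfloor>t / h\<rfloor>) * h\<bar>"
    using \<open>h > 0\<close> by (simp add: abs_mult left_diff_distrib[symmetric])
  also have "\<dots> \<le> \<bar>s - t\<bar> + h"
    using grid_index_bounds[OF \<open>h > 0\<close> \<open>0 \<le> s\<close>] grid_index_bounds[OF \<open>h > 0\<close> \<open>0 \<le> t\<close>]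
      abs_ge_self[of "s - t"] abs_ge_minus_self[of "s - t"]
    unfolding abs_le_iff by linarith
  finally show ?thesis .
qed

lemma lipschitz_quotient_lift_grid:
  fixes F :: "'a::metric_space \<Rightarrow> 'b::metric_space" and \<gamma> :: "real \<Rightarrow> 'b" and T h :: real
  assumes LQ: "lipschitz_quotient L F" and \<gamma>: "1-lipschitz_on {0..T} \<gamma>" "\<gamma> 0 = F x"
    and "0 \<le> T" "0 \<le> h" "h < a"
  obtains p where "p 0 = x" "\<And>k. F (p k) = \<gamma> (min T (real k * h))"
    "\<And>k. dist (p k) (p (Suc k)) < L * a"
proof -
  define w where "w k = \<gamma> (min T (real k * h))" for k
  have w_step: "dist (w k) (w (Suc k)) < a" for k
  proof -
    have "dist (w k) (w (Suc k)) \<le> 1 * dist (min T (real k * h)) (min T (real (Suc k) * h))"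
      unfolding w_def using assms(4,5) by (intro lipschitz_onD[OF \<gamma>(1)]) auto
    also have "\<dots> \<le> h" using \<open>0 \<le> h\<close> by (simp add: dist_real_def algebra_simps)
    finally show ?thesis using \<open>h < a\<close> by simp
  qed
  have w0: "w 0 = F x" using \<gamma>(2) \<open>0 \<le> T\<close> by (simp add: w_def)
  show ?thesis
    using lipschitz_quotient_lift_chain[OF LQ w0 w_step] that unfolding w_def by blast
qed

lemma lipschitz_quotient_approximate_lift:
  fixes F :: "'a::metric_space \<Rightarrow> 'b::metric_space" and \<gamma> :: "real \<Rightarrow> 'b" and T :: real
  assumes LQ: "lipschitz_quotient L F" and \<gamma>: "1-lipschitz_on {0..T} \<gamma>" "\<gamma> 0 = F x"
    and "\<epsilon> > 0"
  shows "\<exists>G. G 0 = x \<and> (\<forall>t\<in>{0..T}. dist (F (G t)) (\<gamma> t) \<le> \<epsilon>) \<and>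
           (\<forall>s\<in>{0..T}. \<forall>t\<in>{0..T}. dist (G s) (G t) \<le> L * dist s t + \<epsilon>)"
proof (cases "T > 0")
  case False
  then have T0: "t = 0" if "t \<in> {0..T}" for t using that by auto
  have "L \<ge> 0" using LQ by (simp add: lipschitz_quotient_def)
  show ?thesis
  proof (intro exI[of _ "\<lambda>_. x"] conjI ballI)
    show "dist (F x) (\<gamma> t) \<le> \<epsilon>" if "t \<in> {0..T}" for t
      using T0[OF that] \<gamma>(2) \<open>\<epsilon> > 0\<close> by simp
    show "dist x x \<le> L * dist s t + \<epsilon>" for s t
      using \<open>L \<ge> 0\<close> \<open>\<epsilon> > 0\<close> by simp
  qed simp
next
  case True
  have L1: "L \<ge> 1" using LQ by (simp add: lipschitz_quotient_def)
  obtain N :: nat where N: "2 * L * T / \<epsilon> < real N"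
    using reals_Archimedean2 by blast
  have "0 < 2 * L * T / \<epsilon>" using True L1 \<open>\<epsilon> > 0\<close> by simp
  then have "N > 0" using N by linarith
  define h where "h = T / real N"
  define \<delta> where "\<delta> = \<epsilon> / (2 * L * real N)"
  have "h > 0" "\<delta> > 0" using True \<open>N > 0\<close> \<open>\<epsilon> > 0\<close> L1 by (simp_all add: h_def \<delta>_def)
  have Nh: "real N * h = T" using \<open>N > 0\<close> by (simp add: h_def)
  have Lh: "L * h < \<epsilon> / 2"
    using N \<open>N > 0\<close> \<open>\<epsilon> > 0\<close> by (simp add: h_def field_simps)
  \<comment> \<open>Each of the at most N grid steps separating two times costs the slack \<delta>.\<close>
  have L\<delta>: "L * (real N * \<delta>) = \<epsilon> / 2"
    using \<open>N > 0\<close> L1 by (simp add: \<delta>_def field_simps)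
  obtain p where p0: "p 0 = x" and pF: "\<And>k. F (p k) = \<gamma> (min T (real k * h))"
    and p_step: "\<And>k. dist (p k) (p (Suc k)) < L * (h + \<delta>)"
    using lipschitz_quotient_lift_grid[OF LQ \<gamma>, where h = h and a = "h + \<delta>"] True \<open>h > 0\<close> \<open>\<delta> > 0\<close>
    by auto
  define idx where "idx t = nat \<lfloor>t / h\<rfloor>" for t
  note idx_bounds = grid_index_bounds[OF \<open>h > 0\<close>, folded idx_def]
  define G where "G t = p (idx t)" for t
  have "dist (F (G t)) (\<gamma> t) \<le> \<epsilon>" if "t \<in> {0..T}" for t
  proof -
    have "real (idx t) * h \<in> {0..T}" using idx_bounds(1)[of t] that \<open>h > 0\<close> by auto
    moreover have "F (G t) = \<gamma> (real (idx t) * h)"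
      using idx_bounds(1)[of t] that by (simp add: G_def pF)
    ultimately have "dist (F (G t)) (\<gamma> t) \<le> 1 * dist (real (idx t) * h) t"
      using lipschitz_onD[OF \<gamma>(1) _ that] by simp
    also have "\<dots> \<le> h" using idx_bounds[of t] that by (simp add: dist_real_def)
    also have "h \<le> L * h" using L1 \<open>h > 0\<close> by simp
    also have "\<dots> \<le> \<epsilon>" using Lh \<open>\<epsilon> > 0\<close> by linarith
    finally show ?thesis .
  qed
  moreover have "dist (G s) (G t) \<le> L * dist s t + \<epsilon>" if "s \<in> {0..T}" "t \<in> {0..T}" for s t
  proof -
    define k where "k = \<bar>real (idx s) - real (idx t)\<bar>"
    have "dist (G s) (G t) \<le> k * (L * (h + \<delta>))"
      unfolding G_def k_def by (rule dist_chain_le) (simp add: less_imp_le p_step)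
    also have "\<dots> = L * (k * h) + L * (k * \<delta>)" by (simp add: algebra_simps)
    also have "\<dots> \<le> L * (dist s t + h) + L * (real N * \<delta>)"
    proof (intro add_mono mult_left_mono mult_right_mono)
      show "k * h \<le> dist s t + h"
        using grid_index_diff[OF \<open>h > 0\<close>, of s t] that by (simp add: k_def idx_def dist_real_def)
      have "idx s \<le> N" "idx t \<le> N"
        using grid_index_le[OF \<open>h > 0\<close>, of _ N] that by (simp_all add: idx_def Nh)
      then show "k \<le> real N" by (simp add: k_def abs_le_iff)
    qed (use L1 \<open>\<delta> > 0\<close> in auto)
    also have "\<dots> < L * dist s t + \<epsilon>" using Lh L\<delta> by (simp add: distrib_left)
    finally show ?thesis by simp
  qed
  moreover have "G 0 = x" by (simp add: G_def idx_def p0)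
  ultimately show ?thesis by blast
qed

lemma function_convergent_subsequence_compact:
  fixes f :: "nat \<Rightarrow> 'b \<Rightarrow> 'a::metric_space"
  assumes "countable S" "compact K" and K: "\<And>n x. x \<in> S \<Longrightarrow> f n x \<in> K"
  obtains k where "strict_mono (k::nat\<Rightarrow>nat)" "\<And>x. x \<in> S \<Longrightarrow> \<exists>l. (\<lambda>n. f (k n) x) \<longlonglongrightarrow> l"
proof (cases "S = {}")
  case True
  then show ?thesis using strict_mono_id that by fastforce
next
  case False
  with \<open>countable S\<close> obtain \<sigma> :: "nat \<Rightarrow> 'b" where \<sigma>: "S = range \<sigma>"
    using uncountable_def by blast
  obtain k where "strict_mono k" and k: "\<And>i. \<exists>l. (\<lambda>n. (f \<circ> k) n (\<sigma> i)) \<longlonglongrightarrow> l"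
  proof (rule subsequence_diagonalization_lemma
      [of "\<lambda>i r. \<exists>l. ((\<lambda>n. (f \<circ> r) n (\<sigma> i)) \<longlongrightarrow> l) sequentially" id])
    show "\<exists>k::nat\<Rightarrow>nat. strict_mono k \<and> (\<exists>l. (\<lambda>n. (f \<circ> (r \<circ> k)) n (\<sigma> i)) \<longlonglongrightarrow> l)" for i r
    proof -
      have "f (r n) (\<sigma> i) \<in> K" for n by (simp add: \<sigma> K)
      then show ?thesis using compact_def [of K] \<open>compact K\<close> by (force simp: o_def)
    qed
    show "\<exists>l. (\<lambda>n. (f \<circ> (r \<circ> k2)) n (\<sigma> i)) \<longlonglongrightarrow> l"
      if "\<exists>l. (\<lambda>n. (f \<circ> (r \<circ> k1)) n (\<sigma> i)) \<longlonglongrightarrow> l" "\<And>j. N \<le> j \<Longrightarrow> \<exists>j'\<ge>j. k2 j = k1 j'"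
      for i N and r k1 k2 :: "nat\<Rightarrow>nat"
      using that
      by (simp add: lim_sequentially) (metis (no_types, opaque_lifting) le_cases order_trans)
  qed auto
  with \<sigma> that show ?thesis by force
qed

lemma Cauchy_at_closure_point:
  fixes f :: "nat \<Rightarrow> 'c::metric_space \<Rightarrow> 'a::metric_space"
  assumes t: "t \<in> closure D" and Cauchy_D: "\<And>d. d \<in> D \<Longrightarrow> Cauchy (\<lambda>n. f n d)"
    and e: "e \<longlonglongrightarrow> 0" and "L \<ge> 0"
    and est: "\<And>n d. d \<in> D \<Longrightarrow> dist (f n d) (f n t) \<le> L * dist d t + e n"
  shows "Cauchy (\<lambda>n. f n t)"
proof (rule metric_CauchyI)
  fix \<epsilon> :: real assume "\<epsilon> > 0"
  obtain d where "d \<in> D" and d: "dist d t < \<epsilon> / (4 * (L + 1))"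
  proof -
    have "\<epsilon> / (4 * (L + 1)) > 0" using \<open>\<epsilon> > 0\<close> \<open>L \<ge> 0\<close> by simp
    then show ?thesis using t that unfolding closure_approachable by blast
  qed
  have "L * dist d t \<le> (L + 1) * (\<epsilon> / (4 * (L + 1)))"
    using d \<open>L \<ge> 0\<close> by (intro mult_mono) auto
  also have "\<dots> = \<epsilon> / 4" using \<open>L \<ge> 0\<close> by (simp add: field_simps)
  finally have near: "L * dist d t \<le> \<epsilon> / 4" .
  obtain M1 where M1: "\<And>m n. M1 \<le> m \<Longrightarrow> M1 \<le> n \<Longrightarrow> dist (f m d) (f n d) < \<epsilon> / 4"
    using metric_CauchyD[OF Cauchy_D[OF \<open>d \<in> D\<close>], of "\<epsilon> / 4"] \<open>\<epsilon> > 0\<close> by auto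
  obtain M2 where M2: "\<And>n. M2 \<le> n \<Longrightarrow> e n < \<epsilon> / 8"
    using LIMSEQ_D[OF e, of "\<epsilon> / 8"] \<open>\<epsilon> > 0\<close> by (force simp: abs_less_iff)
  have close: "dist (f n d) (f n t) < 3 * \<epsilon> / 8" if "M2 \<le> n" for n
    using est[OF \<open>d \<in> D\<close>, of n] near M2[OF that] by linarith
  show "\<exists>M. \<forall>m\<ge>M. \<forall>n\<ge>M. dist (f m t) (f n t) < \<epsilon>"
  proof (intro exI[of _ "max M1 M2"] allI impI)
    fix m n assume "max M1 M2 \<le> m" "max M1 M2 \<le> n"
    then have "dist (f m d) (f m t) < 3 * \<epsilon> / 8" "dist (f n d) (f n t) < 3 * \<epsilon> / 8"
      "dist (f m d) (f n d) < \<epsilon> / 4"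
      using close M1 by auto
    moreover have "dist (f m t) (f n t) \<le> dist (f m d) (f m t) + dist (f m d) (f n d) + dist (f n d) (f n t)"
      by (metis add.commute dist_commute dist_triangle2 dist_triangle_le add_right_mono)
    ultimately show "dist (f m t) (f n t) < \<epsilon>" by linarith
  qed
qed

lemma lipschitz_limit_of_approximately_lipschitz:
  fixes G :: "nat \<Rightarrow> 'c::{metric_space,second_countable_topology} \<Rightarrow> 'a::metric_space"
  assumes "compact K" and K: "\<And>n t. t \<in> S \<Longrightarrow> G n t \<in> K"
    and e: "e \<longlonglongrightarrow> 0" and "L \<ge> 0"
    and est: "\<And>n s t. s \<in> S \<Longrightarrow> t \<in> S \<Longrightarrow> dist (G n s) (G n t) \<le> L * dist s t + e n"
  obtains r g where "strict_mono r" "\<And>t. t \<in> S \<Longrightarrow> (\<lambda>n. G (r n) t) \<longlonglongrightarrow> g t"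
    "L-lipschitz_on S g"
proof -
  obtain D where "countable D" "D \<subseteq> S" "S \<subseteq> closure D"
    using separable by metis
  then obtain r where r: "strict_mono r" and conv_D: "\<And>d. d \<in> D \<Longrightarrow> \<exists>l. (\<lambda>n. G (r n) d) \<longlonglongrightarrow> l"
    using function_convergent_subsequence_compact[OF _ \<open>compact K\<close>, of D G] K by blast
  have er: "(\<lambda>n. e (r n)) \<longlonglongrightarrow> 0"
    using LIMSEQ_subseq_LIMSEQ[OF e r] by (simp add: o_def)
  have "\<exists>l. (\<lambda>n. G (r n) t) \<longlonglongrightarrow> l" if "t \<in> S" for t
  proof -
    have "Cauchy (\<lambda>n. G (r n) t)"
    proof (rule Cauchy_at_closure_point[OF _ _ er \<open>L \<ge> 0\<close>])
      show "t \<in> closure D" using that \<open>S \<subseteq> closure D\<close> by blast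
      show "Cauchy (\<lambda>n. G (r n) d)" if "d \<in> D" for d
        using conv_D[OF that] convergent_Cauchy convergent_def by blast
      show "dist (G (r n) d) (G (r n) t) \<le> L * dist d t + e (r n)" if "d \<in> D" for n d
        using est that \<open>D \<subseteq> S\<close> \<open>t \<in> S\<close> by blast
    qed
    moreover have "\<forall>n. G (r n) t \<in> K" using K that by blast
    ultimately show ?thesis
      using compact_imp_complete[OF \<open>compact K\<close>] unfolding complete_def by (metis (no_types, lifting))
  qed
  then obtain g where g: "\<And>t. t \<in> S \<Longrightarrow> (\<lambda>n. G (r n) t) \<longlonglongrightarrow> g t"
    by metis
  have "dist (g s) (g t) \<le> L * dist s t" if "s \<in> S" "t \<in> S" for s t
  proof -
    have "(\<lambda>n. L * dist s t + e (r n)) \<longlonglongrightarrow> L * dist s t + 0"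
      by (intro tendsto_intros er)
    then have "dist (g s) (g t) \<le> L * dist s t + 0"
      using est that by (intro LIMSEQ_le[OF tendsto_dist[OF g g]]) auto
    then show ?thesis by simp
  qed
  then have "L-lipschitz_on S g" using \<open>L \<ge> 0\<close> by (simp add: lipschitz_on_def)
  with that r g show ?thesis by blast
qed

theorem lemma3p3:
  fixes F :: "'a::metric_space \<Rightarrow> 'b::metric_space"
    and \<gamma> :: "real \<Rightarrow> 'b" and T L :: real and x :: 'a
  assumes "proper_metric_space TYPE('a)"
    and "lipschitz_quotient L F"
    and "1-lipschitz_on {0..T} \<gamma>"
    and "\<gamma> 0 = F x"
  shows "\<exists>g :: real \<Rightarrow> 'a. L-lipschitz_on {0..T} g \<and> g 0 = x \<and>
           (\<forall>t\<in>{0..T}. F (g t) = \<gamma> t)"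
proof (cases "T < 0")
  case True
  then show ?thesis using assms(2) by (intro exI[of _ "\<lambda>_. x"]) (simp add: lipschitz_on_def lipschitz_quotient_def)
next
  case False
  then have "0 \<in> {0..T}" by simp
  have L1: "L \<ge> 1" using assms(2) by (simp add: lipschitz_quotient_def)
  define e where "e n = inverse (real (Suc n))" for n
  have e: "e \<longlonglongrightarrow> 0" unfolding e_def by (rule LIMSEQ_inverse_real_of_nat)
  have approximate_lifts: "\<forall>n. \<exists>G. G 0 = x \<and> (\<forall>t\<in>{0..T}. dist (F (G t)) (\<gamma> t) \<le> e n) \<and>
             (\<forall>s\<in>{0..T}. \<forall>t\<in>{0..T}. dist (G s) (G t) \<le> L * dist s t + e n)"
    using lipschitz_quotient_approximate_lift[OF assms(2-4)] by (simp add: e_def)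
  obtain G where G0: "\<And>n. G n 0 = x"
    and G_err: "\<And>n t. t \<in> {0..T} \<Longrightarrow> dist (F (G n t)) (\<gamma> t) \<le> e n"
    and G_lip: "\<And>n s t. s \<in> {0..T} \<Longrightarrow> t \<in> {0..T} \<Longrightarrow> dist (G n s) (G n t) \<le> L * dist s t + e n"
    using choice[OF approximate_lifts] by blast
  have G_bounded: "G n t \<in> cball x (L * T + 1)" if "t \<in> {0..T}" for n t
  proof -
    have "L * t \<le> L * T" "e n \<le> 1"
      using that L1 by (auto simp: e_def inverse_le_1_iff intro: mult_left_mono)
    then show ?thesis
      using G_lip[OF \<open>0 \<in> {0..T}\<close> that, of n] that by (simp add: G0 dist_real_def)
  qed
  have "compact (cball x (L * T + 1))"
    using assms(1) by (simp add: proper_metric_space_def)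
  moreover have "L \<ge> 0" using L1 by simp
  ultimately obtain r g where r: "strict_mono r"
    and g: "\<And>t. t \<in> {0..T} \<Longrightarrow> (\<lambda>n. G (r n) t) \<longlonglongrightarrow> g t" and g_lip: "L-lipschitz_on {0..T} g"
    using lipschitz_limit_of_approximately_lipschitz[OF _ G_bounded e _ G_lip] by blast
  have "(\<lambda>n. G (r n) 0) \<longlonglongrightarrow> x" by (simp add: G0)
  with g[OF \<open>0 \<in> {0..T}\<close>] have "g 0 = x" by (rule LIMSEQ_unique)
  moreover have "F (g t) = \<gamma> t" if t: "t \<in> {0..T}" for t
  proof (rule LIMSEQ_unique)
    have "continuous_on UNIV F"
      using lipschitz_on_continuous_on lipschitz_quotient_imp_lipschitz[OF assms(2)] .
    then show "(\<lambda>n. F (G (r n) t)) \<longlonglongrightarrow> F (g t)"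
      by (rule continuous_on_tendsto_compose[OF _ g[OF t]]) simp_all
    have er: "(\<lambda>n. e (r n)) \<longlonglongrightarrow> 0" using LIMSEQ_subseq_LIMSEQ[OF e r] by (simp add: o_def)
    have "(\<lambda>n. dist (F (G (r n) t)) (\<gamma> t)) \<longlonglongrightarrow> 0"
      by (rule tendsto_sandwich[OF _ _ tendsto_const er]) (simp_all add: G_err[OF t])
    then show "(\<lambda>n. F (G (r n) t)) \<longlonglongrightarrow> \<gamma> t" by (rule tendsto_dist_iff[THEN iffD2])
  qed
  ultimately show ?thesis using g_lip by blast
qed

end
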